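(* Let $X$ be an ISL and let $x=(x_k)_{k\ge1}\in X$, $x\ne 0$, be totally multiplicative, i.e. $x_{nk}=x_nx_k$ for all $n,k\in\mathbb N$. Then $x$ is $\sigma(X,X')$-cyclic for the dilation semigroup $(D_n)_{n\ge1}$, that is, the $\sigma(X,X')$-closed linear span $E_x$ of $\{D_nx:n\in\mathbb N\}$ equals $X$. (Hence, if $X'=X^*$, the norm-closed linear span of $\{D_nx\}$ is $X$.) In particular, if such an $x$ lies in $X$, $a\in X'$, and $\sum_{k\ge1}a_{nk}x_k=0$ for all $n\ge1$, then $a_j=0$ for all $j\ge1$.
   Context: $\mathbb N=\{1,2,\dots\}$; $\delta_k$ denotes the $k$-th standard unit vector. An ISL (invariant sequence lattice) is a Banach space $X$ of complex sequences $x=(x_n)_{n\ge1}$ such that: (i) if $x\in X$ and $|y_n|\le|x_n|$ for all $n$, then $y\in X$ and $\|y\|_X\le\|x\|_X$; (ii) for every $n\ge1$ the dilation $D_n\big(\sum_kx_k\delta_k\big)=\sum_kx_k\delta_{nk}$ (i.e. $(D_nx)_{nk}=x_k$, and $(D_nx)_m=0$ if $n\nmid m$) maps $X$ into $X$; (iii) $\delta_1\in X$ (so all $\delta_k\in X$). The dual lattice is $X'=\{y=(y_n):\sum_n|x_ny_n|<\infty\ \forall x\in X\}$, with pairing $\langle x,y\rangle=\sum_nx_ny_n$. One has $X'\subset X^*$ (the Banach dual). $\sigma(X,X')$ is the weak topology on $X$ induced by $X'$ through this pairing. *)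

theory Defs
  imports "HOL-Analysis.Analysis" "HOL-Library.Function_Algebras"
begin

text \<open>A complex sequence $(x_n)_{n \ge 1}$ is encoded as a function \<open>x :: nat \<Rightarrow> complex\<close>
  with the dummy value \<open>x 0 = 0\<close>; vector addition is pointwise addition of functions.\<close>

definition seq_scale :: "complex \<Rightarrow> (nat \<Rightarrow> complex) \<Rightarrow> nat \<Rightarrow> complex"
  where "seq_scale c x = (\<lambda>n. c * x n)"

global_interpretation cseq: vector_space seq_scale
  by unfold_locales (auto simp: seq_scale_def fun_eq_iff algebra_simps)

definition unit_seq :: "nat \<Rightarrow> nat \<Rightarrow> complex"
  where "unit_seq k = (\<lambda>n. if n = k then 1 else 0)"

definition dilation :: "nat \<Rightarrow> (nat \<Rightarrow> complex) \<Rightarrow> nat \<Rightarrow> complex"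
  where "dilation n x = (\<lambda>m. if n dvd m then x (m div n) else 0)"

text \<open>The library locale \<open>Metric_space\<close> requires the distance to be nonnegative and symmetric on the
  whole type, so the metric induced by a norm on \<open>X\<close> is set to 0 outside of \<open>X\<close>.\<close>

definition norm_dist ::
  "(nat \<Rightarrow> complex) set \<Rightarrow> ((nat \<Rightarrow> complex) \<Rightarrow> real) \<Rightarrow> (nat \<Rightarrow> complex) \<Rightarrow> (nat \<Rightarrow> complex) \<Rightarrow> real"
  where "norm_dist X N x y = (if x \<in> X \<and> y \<in> X then N (x - y) else 0)"

locale banach_sequence_space =
  fixes X :: "(nat \<Rightarrow> complex) set" and N :: "(nat \<Rightarrow> complex) \<Rightarrow> real"
  assumes index_0: "x \<in> X \<Longrightarrow> x 0 = 0"
    and subspace: "cseq.subspace X"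
    and norm_nonneg: "x \<in> X \<Longrightarrow> 0 \<le> N x"
    and norm_eq_0_iff: "x \<in> X \<Longrightarrow> N x = 0 \<longleftrightarrow> x = 0"
    and norm_scale: "x \<in> X \<Longrightarrow> N (seq_scale c x) = cmod c * N x"
    and norm_triangle: "x \<in> X \<Longrightarrow> y \<in> X \<Longrightarrow> N (x + y) \<le> N x + N y"
    and complete: "Metric_space.mcomplete X (norm_dist X N)"

sublocale banach_sequence_space \<subseteq> Metric_space X "norm_dist X N"
proof
  fix x y z
  show "0 \<le> norm_dist X N x y"
    using norm_nonneg cseq.subspace_diff[OF subspace] by (simp add: norm_dist_def)
  have minus: "x - y = seq_scale (- 1) (y - x)"
    by (auto simp: seq_scale_def fun_eq_iff)
  show "norm_dist X N x y = norm_dist X N y x"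
    using norm_scale[of "y - x" "- 1"] cseq.subspace_diff[OF subspace, of y x]
    unfolding norm_dist_def minus by simp
  show "norm_dist X N x y = 0 \<longleftrightarrow> x = y" if "x \<in> X" "y \<in> X"
    using that norm_eq_0_iff[of "x - y"] cseq.subspace_diff[OF subspace, of x y]
    by (simp add: norm_dist_def)
  show "norm_dist X N x z \<le> norm_dist X N x y + norm_dist X N y z"
    if "x \<in> X" "y \<in> X" "z \<in> X"
    using that norm_triangle[of "x - y" "y - z"] cseq.subspace_diff[OF subspace]
    by (simp add: norm_dist_def)
qed

locale ISL = banach_sequence_space +
  assumes solid: "x \<in> X \<Longrightarrow> (\<And>n. cmod (y n) \<le> cmod (x n)) \<Longrightarrow> y \<in> X \<and> N y \<le> N x"
    and dilation_closed: "n \<ge> 1 \<Longrightarrow> x \<in> X \<Longrightarrow> dilation n x \<in> X"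
    and unit_seq_1: "unit_seq 1 \<in> X"

definition pairing :: "(nat \<Rightarrow> complex) \<Rightarrow> (nat \<Rightarrow> complex) \<Rightarrow> complex"
  where "pairing x y = (\<Sum>\<^sub>\<infinity>n\<in>{1..}. x n * y n)"

definition dual_lattice :: "(nat \<Rightarrow> complex) set \<Rightarrow> (nat \<Rightarrow> complex) set"
  where "dual_lattice X = {y. y 0 = 0 \<and> (\<forall>x\<in>X. (\<lambda>n. cmod (x n * y n)) summable_on {1..})}"

text \<open>The weak topology \<open>\<sigma>(X, X')\<close>: the coarsest topology on \<open>X\<close> for which all functionals
  \<open>\<lambda>x. pairing x y\<close> with \<open>y \<in> X'\<close> are continuous.\<close>

definition lattice_weak_topology :: "(nat \<Rightarrow> complex) set \<Rightarrow> (nat \<Rightarrow> complex) topology"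
  where "lattice_weak_topology X =
    topology_generated_by {{x \<in> X. pairing x y \<in> U} | y U. y \<in> dual_lattice X \<and> open U}"

text \<open>The Banach dual; functionals are made \<open>extensional\<close> so that they are determined by
  their values on \<open>X\<close>.\<close>

definition banach_dual ::
  "(nat \<Rightarrow> complex) set \<Rightarrow> ((nat \<Rightarrow> complex) \<Rightarrow> real) \<Rightarrow> ((nat \<Rightarrow> complex) \<Rightarrow> complex) set"
  where "banach_dual X N = {\<phi> \<in> extensional X.
    (\<forall>x\<in>X. \<forall>y\<in>X. \<phi> (x + y) = \<phi> x + \<phi> y) \<and>
    (\<forall>c. \<forall>x\<in>X. \<phi> (seq_scale c x) = c * \<phi> x) \<and>
    (\<exists>C. \<forall>x\<in>X. cmod (\<phi> x) \<le> C * N x)}"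

text \<open>\<open>X' = X\<^sup>*\<close>, where \<open>y \<in> X'\<close> is identified with the functional \<open>\<lambda>x. pairing x y\<close> on \<open>X\<close>.\<close>

definition dual_lattice_is_banach_dual ::
  "(nat \<Rightarrow> complex) set \<Rightarrow> ((nat \<Rightarrow> complex) \<Rightarrow> real) \<Rightarrow> bool"
  where "dual_lattice_is_banach_dual X N \<longleftrightarrow>
    (\<lambda>y. restrict (\<lambda>x. pairing x y) X) ` dual_lattice X = banach_dual X N"

definition totally_multiplicative :: "(nat \<Rightarrow> complex) \<Rightarrow> bool"
  where "totally_multiplicative x \<longleftrightarrow> (\<forall>n\<ge>1. \<forall>k\<ge>1. x (n * k) = x n * x k)"

definition dilation_span :: "(nat \<Rightarrow> complex) \<Rightarrow> (nat \<Rightarrow> complex) set"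
  where "dilation_span x = cseq.span ((\<lambda>n. dilation n x) ` {1..})"

end

theory Submission
  imports Defs "HOL-Computational_Algebra.Primes"
begin

text \<open>Total multiplicativity makes \<open>x - x\<^sub>p D\<^sub>p x\<close> the restriction of \<open>x\<close> to the integers prime to \<open>p\<close>,
  and the same operation can be iterated. So for every \<open>m\<close> the span of the dilates contains the restriction
  of \<open>x\<close> to the integers without prime factor \<open>\<le> m\<close>. This restriction agrees with \<open>\<delta>\<^sub>1\<close> up to index \<open>m\<close>
  and is dominated by \<open>\<bar>x\<bar>\<close>, so by dominated convergence it tends weakly to \<open>\<delta>\<^sub>1\<close>; dilating
  gives every \<open>\<delta>\<^sub>j\<close>, and finitely supported sequences are weakly dense by dominated convergence again.
  When \<open>X' = X\<^sup>*\<close>, norm density follows from the Hahn--Banach theorem. The latter is obtained by noting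
  that the minimal sublinear functionals (which exist by Zorn's lemma) are exactly the linear ones.\<close>

section \<open>The Hahn--Banach theorem\<close>

locale real_subspace = vector_space scale
  for scale :: "real \<Rightarrow> 'b::ab_group_add \<Rightarrow> 'b" (infixr \<open>\<odot>\<close> 75) +
  fixes V :: "'b set"
  assumes subspace_V: "subspace V"
begin

lemmas V_closed = subspace_0[OF subspace_V] subspace_add[OF subspace_V]
  subspace_scale[OF subspace_V] subspace_neg[OF subspace_V] subspace_diff[OF subspace_V]

section \<open>Sublinear functionals and straightening along a line\<close>

text \<open>Homogeneity is demanded only as an inequality, which is easy to verify for infima;
  \<open>sublinear_scale\<close> recovers equality.\<close>

definition sublinear :: "('b \<Rightarrow> real) \<Rightarrow> bool"
  where "sublinear q \<longleftrightarrow> (\<forall>u\<in>V. \<forall>v\<in>V. q (u + v) \<le> q u + q v) \<and>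
    (\<forall>c\<ge>0. \<forall>u\<in>V. q (c \<odot> u) \<le> c * q u)"

lemma sublinear_add: "sublinear q \<Longrightarrow> u \<in> V \<Longrightarrow> v \<in> V \<Longrightarrow> q (u + v) \<le> q u + q v"
  by (simp add: sublinear_def)

lemma sublinear_scale_le: "sublinear q \<Longrightarrow> c \<ge> 0 \<Longrightarrow> u \<in> V \<Longrightarrow> q (c \<odot> u) \<le> c * q u"
  by (simp add: sublinear_def)

lemma sublinear_0:
  assumes "sublinear q"
  shows "q 0 = 0"
  using sublinear_scale_le[OF assms, of 0 0] sublinear_add[OF assms, of 0 0] V_closed(1) by simp

text \<open>For \<open>c > 0\<close> the reverse inequality is the scaling bound with factor
  \<open>1 / c\<close> at the vector \<open>c \<odot> u\<close>.\<close>

lemma sublinear_scale: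
  assumes q: "sublinear q" and c: "c \<ge> 0" and u: "u \<in> V"
  shows "q (c \<odot> u) = c * q u"
proof (cases "c = 0")
  case True
  then show ?thesis
    using sublinear_0[OF q] by simp
next
  case False
  with c have "c > 0" by simp
  have "q ((1 / c) \<odot> (c \<odot> u)) \<le> (1 / c) * q (c \<odot> u)"
    using \<open>c > 0\<close> u by (intro sublinear_scale_le[OF q]) (auto intro: V_closed)
  then have "c * q u \<le> q (c \<odot> u)"
    using \<open>c > 0\<close> by (simp add: field_simps)
  with sublinear_scale_le[OF assms] show ?thesis
    by simp
qed

text \<open>Split \<open>0 = u + (- u)\<close>. An upper bound at \<open>- u\<close> thus becomes a
  lower bound at \<open>u\<close>, which keeps infima over chains finite.\<close>

lemma sublinear_minus:
  assumes "sublinear q" "u \<in> V"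
  shows "- q (- u) \<le> q u"
  using sublinear_add[OF assms(1,2), of "- u"] sublinear_0[OF assms(1)] V_closed(4)[OF assms(2)]
  by simp

text \<open>The largest sublinear functional below \<open>q\<close> that is linear on the line spanned by \<open>v\<close>
  (and takes the value \<open>q v\<close> at \<open>v\<close>).\<close>

definition straighten :: "'b \<Rightarrow> ('b \<Rightarrow> real) \<Rightarrow> 'b \<Rightarrow> real"
  where "straighten v q u = (if u \<in> V then INF t\<in>{0..}. q (u + t \<odot> v) - t * q v else 0)"

text \<open>A real \<open>INF\<close> is meaningful only over a set bounded below. The bound
  \<open>- q (- u)\<close> comes from writing \<open>t \<odot> v\<close> as
  \<open>(u + t \<odot> v) + (- u)\<close>.\<close>

lemma straighten_le:
  assumes q: "sublinear q" and v: "v \<in> V" and u: "u \<in> V" and t: "t \<ge> 0"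
  shows "straighten v q u \<le> q (u + t \<odot> v) - t * q v"
proof -
  have "bdd_below ((\<lambda>t. q (u + t \<odot> v) - t * q v) ` {0..})"
  proof (rule bdd_belowI2)
    fix t :: real
    assume "t \<in> {0..}"
    then have t: "t \<ge> 0" by simp
    have "q (t \<odot> v) \<le> q (u + t \<odot> v) + q (- u)"
      using sublinear_add[OF q, of "u + t \<odot> v" "- u"] u v V_closed by simp
    then show "- q (- u) \<le> q (u + t \<odot> v) - t * q v"
      using sublinear_scale[OF q t v] by simp
  qed
  then show ?thesis
    using t u unfolding straighten_def by (auto intro: cINF_lower)
qed

lemma straighten_ge:
  assumes "u \<in> V" "\<And>t. t \<ge> 0 \<Longrightarrow> r \<le> q (u + t \<odot> v) - t * q v"
  shows "r \<le> straighten v q u"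
  using assms unfolding straighten_def by (auto intro: cINF_greatest)

text \<open>Parameters \<open>t\<close> for \<open>u\<close> and \<open>s\<close> for
  \<open>w\<close> combine to \<open>t + s\<close> for \<open>u + w\<close>, and the infima are
  taken one variable at a time. For \<open>c > 0\<close>, the parameter \<open>t\<close> for
  \<open>u\<close> corresponds to \<open>c * t\<close> for \<open>c \<odot> u\<close>.\<close>

lemma sublinear_straighten:
  assumes q: "sublinear q" and v: "v \<in> V"
  shows "sublinear (straighten v q)"
  unfolding sublinear_def
proof (intro conjI ballI allI impI)
  fix u w assume u: "u \<in> V" and w: "w \<in> V"
  have "straighten v q (u + w) - (q (w + s \<odot> v) - s * q v) \<le> q (u + t \<odot> v) - t * q v"
    if "t \<ge> 0" "s \<ge> 0" for t s
  proof -
    have "straighten v q (u + w) \<le> q ((u + w) + (t + s) \<odot> v) - (t + s) * q v"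
      using that u w V_closed by (intro straighten_le[OF q v]) auto
    also have "(u + w) + (t + s) \<odot> v = (u + t \<odot> v) + (w + s \<odot> v)"
      by (simp add: scale_left_distrib algebra_simps)
    also have "q \<dots> \<le> q (u + t \<odot> v) + q (w + s \<odot> v)"
      using u w v V_closed by (intro sublinear_add[OF q]) auto
    finally show ?thesis
      by (simp add: algebra_simps)
  qed
  then have "straighten v q (u + w) - (q (w + s \<odot> v) - s * q v) \<le> straighten v q u"
    if "s \<ge> 0" for s
    using that by (intro straighten_ge[OF u])
  then have "straighten v q (u + w) - straighten v q u \<le> q (w + s \<odot> v) - s * q v"
    if "s \<ge> 0" for s
    using that by (simp add: algebra_simps)
  then have "straighten v q (u + w) - straighten v q u \<le> straighten v q w"
    by (intro straighten_ge[OF w])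
  then show "straighten v q (u + w) \<le> straighten v q u + straighten v q w"
    by simp
next
  fix c :: real and u assume c: "c \<ge> 0" and u: "u \<in> V"
  show "straighten v q (c \<odot> u) \<le> c * straighten v q u"
  proof (cases "c = 0")
    case True
    then show ?thesis
      using straighten_le[OF q v V_closed(1), of 0] sublinear_0[OF q] by simp
  next
    case False
    with c have "c > 0" by simp
    have "straighten v q (c \<odot> u) / c \<le> straighten v q u"
    proof (rule straighten_ge[OF u])
      fix t :: real assume t: "t \<ge> 0"
      have "straighten v q (c \<odot> u) \<le> q (c \<odot> u + (c * t) \<odot> v) - (c * t) * q v"
        using c t u V_closed by (intro straighten_le[OF q v]) auto
      also have "c \<odot> u + (c * t) \<odot> v = c \<odot> (u + t \<odot> v)"
        by (simp add: scale_right_distrib)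
      also have "q \<dots> = c * q (u + t \<odot> v)"
        using u v V_closed by (intro sublinear_scale[OF q c]) auto
      finally show "straighten v q (c \<odot> u) / c \<le> q (u + t \<odot> v) - t * q v"
        using \<open>c > 0\<close> by (simp add: field_simps)
    qed
    then show ?thesis
      using \<open>c > 0\<close> by (simp add: field_simps)
  qed
qed

lemma straighten_le_self:
  assumes "sublinear q" "v \<in> V" "u \<in> V"
  shows "straighten v q u \<le> q u"
  using straighten_le[OF assms, of 0] by simp

lemma straighten_minus_le:
  assumes "sublinear q" "v \<in> V"
  shows "straighten v q (- v) \<le> - q v"
  using straighten_le[OF assms V_closed(4)[OF assms(2)], of 1] sublinear_0[OF assms(1)] by simp

text \<open>The parameter \<open>t = 1\<close> gives \<open>q u \<le> q (u + v) - q v\<close>, the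
  reverse of subadditivity.\<close>

lemma additive_if_straighten_eq:
  assumes q: "sublinear q" and v: "v \<in> V" and u: "u \<in> V" and eq: "straighten v q = q"
  shows "q (u + v) = q u + q v"
  using straighten_le[OF q v u, of 1] sublinear_add[OF q u v] eq by simp

section \<open>Minimal sublinear functionals are linear\<close>

lemma exists_minimal_sublinear:
  assumes p: "sublinear p"
  obtains q where "sublinear q" "\<And>u. u \<in> V \<Longrightarrow> q u \<le> p u"
    "\<And>r. sublinear r \<Longrightarrow> (\<And>u. u \<in> V \<Longrightarrow> r u \<le> q u) \<Longrightarrow> (\<And>u. u \<notin> V \<Longrightarrow> r u = 0) \<Longrightarrow> r = q"
proof -
  \<comment> \<open>Values off \<open>V\<close> are normalised to 0 to make the pointwise order antisymmetric.\<close>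
  define A where "A = {q. sublinear q \<and> (\<forall>u\<in>V. q u \<le> p u) \<and> (\<forall>u. u \<notin> V \<longrightarrow> q u = 0)}"
  \<comment> \<open>The order is reversed, so that the maximal element given by Zorn's lemma is a
    minimal functional. Nonempty chains are bounded by their pointwise infimum.\<close>
  define P where "P = (\<lambda>q r :: 'b \<Rightarrow> real. \<forall>u. r u \<le> q u)"
  have "\<exists>m\<in>A. \<forall>a\<in>A. P m a \<longrightarrow> a = m"
  proof (rule predicate_Zorn)
    show "partial_order_on A (relation_of P A)"
      by (rule partial_order_on_relation_ofI)
        (auto simp: P_def fun_eq_iff intro: order_trans order_antisym)
  next
    fix C assume "C \<in> Chains (relation_of P A)"
    then have C: "C \<subseteq> A" and chain: "\<And>q r. q \<in> C \<Longrightarrow> r \<in> C \<Longrightarrow> P q r \<or> P r q"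
      by (auto simp: Chains_def relation_of_def)
    show "\<exists>u\<in>A. \<forall>a\<in>C. P a u"
    proof (cases "C = {}")
      case True
      have "(\<lambda>u. if u \<in> V then p u else 0) \<in> A"
        using p V_closed by (auto simp: A_def sublinear_def)
      with True show ?thesis
        by blast
    next
      case False
      define m where "m = (\<lambda>u. INF q\<in>C. q u)"
      have bdd: "bdd_below ((\<lambda>q. q u) ` C)" for u
      proof (cases "u \<in> V")
        case True
        have "- p (- u) \<le> q u" if "q \<in> C" for q
        proof -
          have "sublinear q" "q (- u) \<le> p (- u)"
            using that C V_closed(4)[OF True] by (auto simp: A_def)
          with sublinear_minus[OF _ True, of q] show ?thesis
            by simp
        qed
        then show ?thesis
          by (intro bdd_belowI2)
      next
        case False
        then show ?thesis
          using C by (intro bdd_belowI2[of _ 0]) (auto simp: A_def)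
      qed
      have le: "m u \<le> q u" if "q \<in> C" for q u
        unfolding m_def by (rule cINF_lower[OF bdd that])
      have ge: "r \<le> m u" if "\<And>q. q \<in> C \<Longrightarrow> r \<le> q u" for r u
        unfolding m_def using False that by (intro cINF_greatest)
      have "sublinear m"
        unfolding sublinear_def
      proof (intro conjI ballI allI impI)
        fix u v assume uv: "u \<in> V" "v \<in> V"
        have "m (u + v) \<le> q u + r v" if "q \<in> C" "r \<in> C" for q r
        proof -
          \<comment> \<open>The smaller of \<open>q\<close> and \<open>r\<close> lies below both, so
            one functional \<open>s\<close> serves both terms.\<close>
          obtain s where s: "s \<in> C" "s u \<le> q u" "s v \<le> r v"
            using chain[of q r] \<open>q \<in> C\<close> \<open>r \<in> C\<close> unfolding P_def by (meson order_refl)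
          have "m (u + v) \<le> s (u + v)"
            by (rule le[OF s(1)])
          also have "\<dots> \<le> s u + s v"
            using s(1) C uv by (intro sublinear_add) (auto simp: A_def)
          finally show ?thesis
            using s by simp
        qed
        then have "m (u + v) - r v \<le> m u" if "r \<in> C" for r
          using that by (intro ge) (simp add: algebra_simps)
        then have "m (u + v) - m u \<le> m v"
          by (intro ge) (simp add: algebra_simps)
        then show "m (u + v) \<le> m u + m v"
          by simp
      next
        fix c :: real and u assume c: "c \<ge> 0" and u: "u \<in> V"
        have *: "m (c \<odot> u) \<le> c * q u" if "q \<in> C" for q
        proof -
          have "sublinear q"
            using that C by (auto simp: A_def)
          then show ?thesis
            using le[OF that, of "c \<odot> u"] sublinear_scale_le[OF _ c u, of q] by linarith
        qed
        show "m (c \<odot> u) \<le> c * m u"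
        proof (cases "c = 0")
          case True
          then show ?thesis
            using * False by auto
        next
          case False
          then have "m (c \<odot> u) / c \<le> m u"
            using * c by (intro ge) (simp add: field_simps)
          then show ?thesis
            using False c by (simp add: field_simps)
        qed
      qed
      moreover have "m u \<le> p u" if "u \<in> V" for u
      proof -
        obtain q where "q \<in> C"
          using False by blast
        then show ?thesis
          using le[of q u] C that by (auto simp: A_def intro: order_trans)
      qed
      moreover have "m u = 0" if "u \<notin> V" for u
      proof -
        have "m u = (INF q\<in>C. 0)"
          unfolding m_def using C that by (intro INF_cong) (auto simp: A_def)
        then show ?thesis
          using False by simp
      qed
      ultimately have "m \<in> A"
        by (simp add: A_def)
      with le show ?thesis
        unfolding P_def by blast
    qed
  qed
  then obtain q where q: "q \<in> A" and min: "\<And>r. r \<in> A \<Longrightarrow> P q r \<Longrightarrow> r = q"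
    by blast
  show ?thesis
  proof (rule that)
    show "sublinear q" "\<And>u. u \<in> V \<Longrightarrow> q u \<le> p u"
      using q by (auto simp: A_def)
    fix r assume r: "sublinear r" "\<And>u. u \<in> V \<Longrightarrow> r u \<le> q u" "\<And>u. u \<notin> V \<Longrightarrow> r u = 0"
    show "r = q"
    proof (rule min)
      show "r \<in> A"
        using q r by (auto simp: A_def intro: order_trans)
      show "P q r"
        unfolding P_def
      proof
        fix u show "r u \<le> q u"
          using q r by (cases "u \<in> V") (auto simp: A_def)
      qed
    qed
  qed
qed

text \<open>A minimal \<open>q\<close> below \<open>straighten v p\<close> cannot be lowered by
  straightening along any \<open>w\<close>, hence is additive. Starting from
  \<open>straighten v p\<close> instead of \<open>p\<close> forces
  \<open>q (- v) \<le> - p v\<close>, hence \<open>q v = p v\<close>.\<close>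

theorem hahn_banach:
  assumes p: "sublinear p" and v: "v \<in> V"
  obtains f where "\<And>u w. u \<in> V \<Longrightarrow> w \<in> V \<Longrightarrow> f (u + w) = f u + f w"
    "\<And>c u. u \<in> V \<Longrightarrow> f (c \<odot> u) = c * f u"
    "\<And>u. u \<in> V \<Longrightarrow> f u \<le> p u" "f v = p v"
proof -
  obtain q where q: "sublinear q" "\<And>u. u \<in> V \<Longrightarrow> q u \<le> straighten v p u"
    and min: "\<And>r. sublinear r \<Longrightarrow> (\<And>u. u \<in> V \<Longrightarrow> r u \<le> q u) \<Longrightarrow>
      (\<And>u. u \<notin> V \<Longrightarrow> r u = 0) \<Longrightarrow> r = q"
    using exists_minimal_sublinear[OF sublinear_straighten[OF p v]] by metis
  have add: "q (u + w) = q u + q w" if "u \<in> V" "w \<in> V" for u w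
  proof (rule additive_if_straighten_eq[OF q(1) that(2,1)])
    show "straighten w q = q"
      using q(1) that(2)
      by (intro min sublinear_straighten straighten_le_self) (auto simp: straighten_def)
  qed
  have minus: "q (- u) = - q u" if "u \<in> V" for u
    using add[OF that V_closed(4)[OF that]] sublinear_0[OF q(1)] by simp
  have le: "q u \<le> p u" if "u \<in> V" for u
    using q(2)[OF that] straighten_le_self[OF p v that] by simp
  show ?thesis
  proof (rule that[OF add _ le])
    fix c u assume u: "u \<in> V"
    show "q (c \<odot> u) = c * q u"
    proof (cases "c \<ge> 0")
      case True
      then show ?thesis
        by (rule sublinear_scale[OF q(1) _ u])
    next
      case False
      then have "q ((- c) \<odot> u) = - c * q u"
        by (intro sublinear_scale[OF q(1) _ u]) simp
      then show ?thesis
        using minus[OF V_closed(3)[OF u, of c]] by simp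
    qed
  next
    have "q (- v) \<le> - p v"
      using q(2)[OF V_closed(4)[OF v]] straighten_minus_le[OF p v] by simp
    then show "q v = p v"
      using minus[OF v] le[OF v] by simp
  qed
qed

end

section \<open>Sieving a totally multiplicative sequence\<close>

lemma dilation_add: "dilation n (x + y) = dilation n x + dilation n y"
  by (auto simp: dilation_def fun_eq_iff)

lemma dilation_scale: "dilation n (seq_scale c x) = seq_scale c (dilation n x)"
  by (auto simp: dilation_def seq_scale_def fun_eq_iff)

lemma dilation_dilation:
  assumes "n \<ge> 1" "m \<ge> 1"
  shows "dilation n (dilation m x) = dilation (n * m) x"
proof
  fix k
  show "dilation n (dilation m x) k = dilation (n * m) x k"
  proof (cases "n dvd k")
    case True
    then obtain l where "k = n * l" ..
    then show ?thesis
      using assms by (auto simp: dilation_def)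
  next
    case False
    then have "\<not> n * m dvd k"
      by (meson dvd_mult_left)
    with False show ?thesis
      by (simp add: dilation_def)
  qed
qed

text \<open>The semigroup law sends generators to generators; this is what allows the sieve step to
  be iterated.\<close>

lemma dilation_in_dilation_span:
  assumes "n \<ge> 1" "z \<in> dilation_span x"
  shows "dilation n z \<in> dilation_span x"
  using assms(2) unfolding dilation_span_def
proof (induction rule: cseq.span_induct_alt)
  case base
  have "dilation n 0 = 0"
    by (auto simp: dilation_def fun_eq_iff)
  then show ?case
    by (simp only: cseq.span_zero)
next
  case (step c u v)
  then obtain m where m: "m \<ge> 1" "u = dilation m x"
    by auto
  then have "dilation (n * m) x \<in> cseq.span ((\<lambda>n. dilation n x) ` {1..})"
    using assms(1) by (intro cseq.span_base) auto
  with step.IH show ?case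
    unfolding dilation_add dilation_scale m(2) dilation_dilation[OF assms(1) m(1)]
    by (intro cseq.span_add cseq.span_scale)
qed

text \<open>Ranging over all \<open>d\<close>, not just primes, selects the same indices: a divisor
  in \<open>{2..m}\<close> has a prime factor at most \<open>m\<close>.\<close>

definition sieve :: "nat \<Rightarrow> (nat \<Rightarrow> complex) \<Rightarrow> nat \<Rightarrow> complex"
  where "sieve m x = (\<lambda>n. if \<forall>d\<in>{2..m}. \<not> d dvd n then x n else 0)"

text \<open>Multiples of a composite \<open>Suc m\<close> are already removed through a prime factor
  at most \<open>m\<close>; for \<open>m = 0\<close> both ranges of divisors are empty.\<close>

lemma sieve_Suc_not_prime:
  assumes "\<not> prime (Suc m)"
  shows "sieve (Suc m) x = sieve m x"
proof -
  have "\<exists>d\<in>{2..m}. d dvd n" if "Suc m dvd n" "m \<ge> 1" for n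
  proof -
    obtain p where p: "prime p" "p dvd Suc m"
      using prime_factor_nat[of "Suc m"] \<open>m \<ge> 1\<close> by auto
    then have "p \<noteq> Suc m" "p \<le> Suc m" "p \<ge> 2"
      using assms prime_ge_2_nat by (auto dest: dvd_imp_le)
    then show ?thesis
      using p that by (intro bexI[of _ p]) (auto intro: dvd_trans)
  qed
  moreover have "{2..Suc m} = insert (Suc m) {2..m}" if "m \<ge> 1"
    using that by auto
  ultimately have "(\<forall>d\<in>{2..Suc m}. \<not> d dvd n) \<longleftrightarrow> (\<forall>d\<in>{2..m}. \<not> d dvd n)" for n
    by (cases "m \<ge> 1") auto
  then show ?thesis
    by (simp add: sieve_def)
qed

text \<open>For a prime \<open>p = Suc m\<close> the subtracted term is exactly the part of
  \<open>sieve m x\<close> on multiples of \<open>p\<close>: the values agree by multiplicativity,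
  and a factor \<open>p\<close> does not affect divisibility by any \<open>d\<close> in
  \<open>{2..m}\<close>.\<close>

lemma sieve_Suc_prime:
  assumes "totally_multiplicative x" "x 0 = 0" and p: "prime (Suc m)"
  shows "sieve (Suc m) x = sieve m x - seq_scale (x (Suc m)) (dilation (Suc m) (sieve m x))"
proof
  fix n
  show "sieve (Suc m) x n = (sieve m x - seq_scale (x (Suc m)) (dilation (Suc m) (sieve m x))) n"
  proof (cases "Suc m dvd n")
    case False
    then show ?thesis
      by (auto simp: sieve_def dilation_def seq_scale_def le_Suc_eq)
  next
    case True
    then obtain k where k: "n = Suc m * k" ..
    have "d dvd n \<longleftrightarrow> d dvd k" if "d \<in> {2..m}" for d
    proof -
      have "\<not> Suc m dvd d"
        using that by (auto dest: dvd_imp_le)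
      then have "coprime d (Suc m)"
        using p by (metis coprime_commute prime_imp_coprime)
      then show ?thesis
        unfolding k by (rule coprime_dvd_mult_right_iff)
    qed
    then have "(\<forall>d\<in>{2..m}. \<not> d dvd n) \<longleftrightarrow> (\<forall>d\<in>{2..m}. \<not> d dvd k)"
      by blast
    moreover have "x n = x (Suc m) * x k"
    proof (cases "k = 0")
      case False
      then have "Suc m \<ge> 1" "k \<ge> 1"
        by simp_all
      then show ?thesis
        using assms(1) unfolding k totally_multiplicative_def by blast
    qed (simp add: k assms(2))
    ultimately have "sieve m x n = x (Suc m) * sieve m x k"
      by (simp add: sieve_def)
    moreover have "dilation (Suc m) (sieve m x) n = sieve m x k"
      unfolding k dilation_def by (simp del: mult_Suc)
    moreover have "m \<ge> 1"
      using p prime_ge_2_nat[OF p] by simp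
    then have "sieve (Suc m) x n = 0"
      using True by (auto simp: sieve_def)
    ultimately show ?thesis
      by (simp add: seq_scale_def)
  qed
qed

lemma sieve_in_dilation_span:
  assumes "totally_multiplicative x" "x 0 = 0"
  shows "sieve m x \<in> dilation_span x"
proof (induction m)
  case 0
  have "sieve 0 x = dilation 1 x"
    by (auto simp: sieve_def dilation_def)
  then show ?case
    by (auto simp: dilation_span_def intro!: cseq.span_base)
next
  case (Suc m)
  show ?case
  proof (cases "prime (Suc m)")
    case False
    with Suc show ?thesis
      by (simp add: sieve_Suc_not_prime)
  next
    case True
    have "dilation (Suc m) (sieve m x) \<in> dilation_span x"
      using Suc by (intro dilation_in_dilation_span) auto
    with Suc show ?thesis
      unfolding sieve_Suc_prime[OF assms True] dilation_span_def
      by (intro cseq.span_diff cseq.span_scale)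
  qed
qed

text \<open>If \<open>k = j * l\<close> with \<open>2 \<le> l\<close>, then \<open>l \<le> m\<close>
  divides itself and is sieved out; only \<open>l = 1\<close> leaves a nonzero value.\<close>

lemma dilation_sieve_eq_unit_seq:
  assumes "x 1 = 1" "x 0 = 0" "j \<ge> 1" "k \<le> m"
  shows "dilation j (sieve m x) k = unit_seq j k"
proof (cases "j dvd k")
  case False
  then show ?thesis
    by (auto simp: dilation_def unit_seq_def)
next
  case True
  then obtain l where k: "k = j * l" ..
  have "l \<le> k"
    using assms(3) k by simp
  have "sieve m x l = 0" if "l \<ge> 2"
  proof -
    have "l \<in> {2..m}"
      using that assms(4) \<open>l \<le> k\<close> by simp
    then have "\<not> (\<forall>d\<in>{2..m}. \<not> d dvd l)"
      using dvd_refl by blast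
    then show ?thesis
      by (simp only: sieve_def if_False)
  qed
  then show ?thesis
    using assms k
    by (cases "l = 0 \<or> l = 1") (auto simp: dilation_def unit_seq_def sieve_def)
qed

lemma cmod_sieve_le: "cmod (sieve m x n) \<le> cmod (x n)"
  by (simp add: sieve_def)

section \<open>Weak convergence\<close>

lemma dual_lattice_summable:
  assumes "a \<in> dual_lattice X" "z \<in> X"
  shows "(\<lambda>n. cmod (z n * a n)) summable_on {1..}" "(\<lambda>n. z n * a n) summable_on {1..}"
  using assms by (auto simp: dual_lattice_def intro: abs_summable_summable)

lemma pairing_add:
  assumes "a \<in> dual_lattice X" "y \<in> X" "z \<in> X"
  shows "pairing (y + z) a = pairing y a + pairing z a"
  using dual_lattice_summable(2)[OF assms(1)] assms(2,3)
  by (simp add: pairing_def distrib_right infsum_add)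

lemma pairing_scale: "pairing (seq_scale c z) a = c * pairing z a"
  by (simp add: pairing_def seq_scale_def mult.assoc infsum_cmult_right')

lemma pairing_unit_seq:
  assumes "j \<ge> 1"
  shows "pairing (unit_seq j) a = a j"
proof -
  have "pairing (unit_seq j) a = infsum (\<lambda>n. unit_seq j n * a n) {j}"
    unfolding pairing_def using assms by (intro infsum_cong_neutral) (auto simp: unit_seq_def)
  then show ?thesis
    by (simp add: unit_seq_def)
qed

text \<open>Translates the vanishing sums of the last claim into annihilation of every dilate of
  \<open>x\<close>.\<close>

lemma pairing_dilation:
  assumes "n \<ge> 1"
  shows "pairing (dilation n x) a = (\<Sum>\<^sub>\<infinity>k\<in>{1..}. a (n * k) * x k)"
proof -
  have "inj_on ((*) n) {1..}"
    using assms by (auto simp: inj_on_def)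
  then have "(\<Sum>\<^sub>\<infinity>k\<in>{1..}. a (n * k) * x k) = infsum (\<lambda>m. dilation n x m * a m) ((*) n ` {1..})"
    using assms by (subst infsum_reindex) (auto simp: o_def dilation_def mult.commute)
  also have "\<dots> = pairing (dilation n x) a"
    unfolding pairing_def using assms
    by (intro infsum_cong_neutral) (auto simp: dilation_def Suc_le_eq image_iff elim!: dvdE)
  finally show ?thesis ..
qed

text \<open>Since \<open>f i\<close> and \<open>z\<close> agree up to index \<open>i\<close>, the
  error is at most the tail beyond \<open>i\<close> of the convergent sum of
  \<open>cmod (w n * a n)\<close>.\<close>

lemma pairing_tendsto_dominated:
  assumes a: "a \<in> dual_lattice X" and X: "\<And>i. f i \<in> X" "z \<in> X" "w \<in> X"
    and dom: "\<And>i k. cmod (f i k - z k) \<le> cmod (w k)"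
    and eq: "\<And>i k. k \<le> i \<Longrightarrow> f i k = z k"
  shows "(\<lambda>i. pairing (f i) a) \<longlonglongrightarrow> pairing z a"
proof -
  define g where "g = (\<lambda>n. cmod (w n * a n))"
  note sum = dual_lattice_summable[OF a]
  have g: "g summable_on {1..}"
    unfolding g_def by (rule sum(1)[OF X(3)])
  \<comment> \<open>The initial segments are cofinal among the finite subsets, so the unordered sum
    is the limit of ordinary partial sums.\<close>
  have "filterlim (\<lambda>i. {1..i}) (finite_subsets_at_top {1..}) (sequentially :: nat filter)"
    unfolding filterlim_finite_subsets_at_top
  proof (intro allI impI)
    fix F :: "nat set" assume F: "finite F \<and> F \<subseteq> {1..}"
    then obtain m where "\<forall>n\<in>F. n \<le> m"
      using finite_nat_set_iff_bounded_le by blast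
    with F show "\<forall>\<^sub>F i in sequentially. finite {1..i} \<and> F \<subseteq> {1..i} \<and> {1..i} \<subseteq> {1..}"
      by (intro eventually_sequentiallyI[of m]) fastforce
  qed
  with g have "(\<lambda>i. sum g {1..i}) \<longlonglongrightarrow> infsum g {1..}"
    using filterlim_compose has_sum_def has_sum_infsum by blast
  from tendsto_diff[OF tendsto_const this, of "infsum g {1..}"]
  have tail: "(\<lambda>i. infsum g {1..} - sum g {1..i}) \<longlonglongrightarrow> 0"
    by simp
  have bound: "norm (pairing (f i) a - pairing z a) \<le> infsum g {1..} - sum g {1..i}" for i
  proof -
    have "((\<lambda>n. (f i n - z n) * a n) has_sum pairing (f i) a - pairing z a) {1..}"
      using has_sum_add[OF has_sum_infsum[OF sum(2)[OF X(1)[of i]]]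
          has_sum_uminusI[OF has_sum_infsum[OF sum(2)[OF X(2)]]]]
      by (simp add: pairing_def left_diff_distrib)
    also have "?this \<longleftrightarrow>
        ((\<lambda>n. (f i n - z n) * a n) has_sum pairing (f i) a - pairing z a) ({1..} - {1..i})"
      using eq by (intro has_sum_cong_neutral) auto
    finally show ?thesis
    proof (rule norm_infsum_le)
      show "(g has_sum infsum g {1..} - sum g {1..i}) ({1..} - {1..i})"
        using g by (intro has_sum_Diff has_sum_infsum has_sum_finite) auto
      show "norm ((f i n - z n) * a n) \<le> g n" for n
        unfolding g_def norm_mult by (intro mult_right_mono dom) auto
    qed
  qed
  have "(\<lambda>i. pairing (f i) a - pairing z a) \<longlonglongrightarrow> 0"
    by (rule Lim_null_comparison[OF _ tail]) (use bound in auto)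
  then show ?thesis
    by (rule LIM_zero_cancel)
qed

section \<open>Limits and closures in the weak topology\<close>

lemma topspace_lattice_weak_topology: "topspace (lattice_weak_topology X) = X"
proof -
  have "0 \<in> dual_lattice X"
    by (simp add: dual_lattice_def)
  then show ?thesis
    unfolding lattice_weak_topology_def topology_generated_by_topspace by blast
qed

text \<open>Convergence is checked on the generating sets and carried through finite intersections
  and arbitrary unions by induction.\<close>

lemma limitin_lattice_weak_topology:
  assumes "\<And>i. f i \<in> X" "z \<in> X"
    and lim: "\<And>a. a \<in> dual_lattice X \<Longrightarrow> ((\<lambda>i. pairing (f i) a) \<longlongrightarrow> pairing z a) F"
  shows "limitin (lattice_weak_topology X) f z F"
  unfolding limitin_def topspace_lattice_weak_topology
proof (intro conjI allI impI)
  fix U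
  assume U: "openin (lattice_weak_topology X) U \<and> z \<in> U"
  then have "generate_topology_on {{x \<in> X. pairing x y \<in> V} | y V. y \<in> dual_lattice X \<and> open V} U"
    by (simp add: lattice_weak_topology_def openin_topology_generated_by)
  then have "z \<in> U \<longrightarrow> eventually (\<lambda>i. f i \<in> U) F"
  proof induction
    case (Basis s)
    then obtain a V where s: "s = {x \<in> X. pairing x a \<in> V}" "a \<in> dual_lattice X" "open V"
      by blast
    then show ?case
      using topological_tendstoD[OF lim[OF s(2)] s(3)] assms(1) by simp
  next
    case (UN K)
    show ?case
    proof
      assume "z \<in> \<Union>K"
      then obtain k where k: "k \<in> K" "z \<in> k"
        by blast
      then have "eventually (\<lambda>i. f i \<in> k) F"
        using UN.IH by blast
      then show "eventually (\<lambda>i. f i \<in> \<Union>K) F"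
        by eventually_elim (use k in blast)
    qed
  qed (auto simp: eventually_conj_iff)
  with U show "eventually (\<lambda>i. f i \<in> U) F"
    by blast
qed (fact assms(2))

text \<open>The kernel of a weakly continuous functional is closed: its complement is a generating
  set.\<close>

lemma pairing_closure_of_eq_0:
  assumes "a \<in> dual_lattice X" "\<And>z. z \<in> S \<Longrightarrow> pairing z a = 0"
    and "y \<in> lattice_weak_topology X closure_of S"
  shows "pairing y a = 0"
proof (rule ccontr)
  assume "pairing y a \<noteq> 0"
  let ?U = "{z \<in> X. pairing z a \<in> - {0}}"
  have "openin (lattice_weak_topology X) ?U"
    unfolding lattice_weak_topology_def
    by (rule topology_generated_by_Basis) (use assms(1) in blast)
  moreover have "y \<in> ?U"
    using \<open>pairing y a \<noteq> 0\<close> assms(3) by (auto simp: in_closure_of topspace_lattice_weak_topology)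
  ultimately obtain z where "z \<in> S" "z \<in> ?U"
    using assms(3) by (meson in_closure_of)
  then show False
    using assms(2) by simp
qed

section \<open>Cyclicity\<close>

lemma sum_seq_apply: "(\<Sum>j\<in>A. f j) k = (\<Sum>j\<in>A. f j k)" for f :: "'a \<Rightarrow> nat \<Rightarrow> complex"
  by (induction A rule: infinite_finite_induct) auto

context ISL
begin

lemma dilation_span_subset:
  assumes "x \<in> X"
  shows "dilation_span x \<subseteq> X"
  unfolding dilation_span_def
  using assms dilation_closed by (intro cseq.span_minimal subspace) auto

lemma pairing_dilation_span_eq_0:
  assumes "a \<in> dual_lattice X" "x \<in> X" "\<And>n. n \<ge> 1 \<Longrightarrow> pairing (dilation n x) a = 0"
    and "z \<in> dilation_span x"
  shows "pairing z a = 0"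
proof -
  have "cseq.subspace {z \<in> X. pairing z a = 0}"
    using subspace assms(1)
    by (auto simp: cseq.subspace_def pairing_add pairing_scale)
      (simp add: pairing_def)
  then have "dilation_span x \<subseteq> {z \<in> X. pairing z a = 0}"
    unfolding dilation_span_def using assms dilation_closed by (intro cseq.span_minimal) auto
  with assms(4) show ?thesis
    by blast
qed

lemma unit_seq_in:
  assumes "j \<ge> 1"
  shows "unit_seq j \<in> X"
proof -
  have "dilation j (unit_seq 1) = unit_seq j"
    using assms by (auto simp: dilation_def unit_seq_def fun_eq_iff elim!: dvdE)
  then show ?thesis
    using dilation_closed[OF assms unit_seq_1] by simp
qed

text \<open>Two dominated limits: sieved combinations tend to a truncation of \<open>y\<close>, and
  truncations tend to \<open>y\<close>. Treating a whole truncation at once avoids showing that the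
  closure is a subspace.\<close>

theorem weak_closure_dilation_span:
  assumes x: "x \<in> X" "x \<noteq> 0" "totally_multiplicative x"
  shows "lattice_weak_topology X closure_of dilation_span x = X"
proof
  let ?C = "lattice_weak_topology X closure_of dilation_span x"
  show "?C \<subseteq> X"
    using closure_of_subset_topspace topspace_lattice_weak_topology by metis
  have x0: "x 0 = 0"
    by (rule index_0[OF x(1)])
  \<comment> \<open>Cancelling a nonzero \<open>x n\<close> in \<open>x n = x n * x 1\<close>
    normalises \<open>x 1\<close> to 1.\<close>
  obtain n where "x n \<noteq> 0"
    using x(2) by (auto simp: fun_eq_iff)
  then have "n \<ge> 1" "x n = x n * x 1"
    using x0 x(3) by (cases n; force simp: totally_multiplicative_def)+
  then have x1: "x 1 = 1"
    using \<open>x n \<noteq> 0\<close> by simp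
  have closed: "z \<in> ?C"
    if "\<And>i. f i \<in> ?C" "z \<in> X" "w \<in> X" "\<And>i k. cmod (f i k - z k) \<le> cmod (w k)"
      "\<And>i k. k \<le> i \<Longrightarrow> f i k = z k" for f :: "nat \<Rightarrow> nat \<Rightarrow> complex" and z w
  proof (rule limitin_closedin)
    have "\<And>i. f i \<in> X"
      using that(1) \<open>?C \<subseteq> X\<close> by blast
    then show "limitin (lattice_weak_topology X) f z sequentially"
      using that by (intro limitin_lattice_weak_topology pairing_tendsto_dominated[of _ X f z w])
  qed (use that(1) in auto)
  have trunc: "(\<lambda>k. if k \<le> K then y k else 0) \<in> ?C" if "y \<in> X" for y K
  proof -
    define f where "f = (\<lambda>m. \<Sum>j\<in>{1..K}. seq_scale (y j) (dilation j (sieve m x)))"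
    \<comment> \<open>The moduli of both terms in the error at \<open>j\<close>; solidity puts them
      into \<open>X\<close>, so their sum \<open>w\<close> can dominate independently of
      \<open>m\<close>.\<close>
    define h where "h = (\<lambda>j k. complex_of_real (cmod (y j * dilation j x k) + cmod (y j * unit_seq j k)))"
    define w where "w = (\<Sum>j\<in>{1..K}. h j)"
    let ?z = "\<lambda>k. if k \<le> K then y k else 0"
    have z: "?z k = (\<Sum>j\<in>{1..K}. y j * unit_seq j k)" for k
    proof -
      have "(\<Sum>j\<in>{1..K}. y j * unit_seq j k) = (\<Sum>j\<in>{1..K}. if j = k then y j else 0)"
        by (intro sum.cong) (auto simp: unit_seq_def)
      then show ?thesis
        using index_0[OF that] by (cases "k = 0") auto
    qed
    have f_apply: "f m k = (\<Sum>j\<in>{1..K}. y j * dilation j (sieve m x) k)" for m k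
      by (simp add: f_def sum_seq_apply seq_scale_def)
    have "h j \<in> X" if j: "j \<in> {1..K}" for j
    proof -
      have s: "seq_scale (y j) u \<in> X" if "u \<in> X" for u
        using that subspace by (simp add: cseq.subspace_def)
      have "(\<lambda>k. of_real (cmod (seq_scale (y j) u k))) \<in> X" if "u \<in> X" for u
        using solid[OF s[OF that], of "\<lambda>k. of_real (cmod (seq_scale (y j) u k))"] by simp
      then have "(\<lambda>k. of_real (cmod (seq_scale (y j) (dilation j x) k)))
          + (\<lambda>k. of_real (cmod (seq_scale (y j) (unit_seq j) k))) \<in> X"
        using j x(1) by (intro cseq.subspace_add[OF subspace]) (auto simp: dilation_closed unit_seq_in)
      then show ?thesis
        by (simp add: h_def seq_scale_def plus_fun_def)
    qed
    then have "w \<in> X"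
      unfolding w_def by (intro cseq.subspace_sum[OF subspace])
    show ?thesis
    proof (rule closed)
      fix m
      have "f m \<in> dilation_span x"
        unfolding f_def dilation_span_def
        using dilation_in_dilation_span[OF _ sieve_in_dilation_span[OF x(3) x0]]
        by (intro cseq.span_sum cseq.span_scale) (simp add: dilation_span_def)
      then show "f m \<in> ?C"
        using closure_of_subset[of "dilation_span x" "lattice_weak_topology X"]
          dilation_span_subset[OF x(1)] by (auto simp: topspace_lattice_weak_topology)
    next
      show "?z \<in> X"
        using solid[OF that, of ?z] by simp
      show "w \<in> X"
        by fact
    next
      fix m k
      have "cmod (f m k - ?z k)
          \<le> (\<Sum>j\<in>{1..K}. cmod (y j * dilation j (sieve m x) k - y j * unit_seq j k))"
        unfolding f_apply z sum_subtractf[symmetric] by (rule norm_sum)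
      also have "\<dots> \<le> (\<Sum>j\<in>{1..K}. cmod (y j * dilation j x k) + cmod (y j * unit_seq j k))"
      proof (intro sum_mono order_trans[OF norm_triangle_ineq4] add_right_mono)
        fix j
        show "cmod (y j * dilation j (sieve m x) k) \<le> cmod (y j * dilation j x k)"
          using cmod_sieve_le by (auto simp: dilation_def norm_mult intro!: mult_left_mono)
      qed
      also have "\<dots> = cmod (w k)"
        unfolding w_def sum_seq_apply h_def of_real_sum[symmetric] norm_of_real
        by (intro abs_of_nonneg[symmetric] sum_nonneg) auto
      finally show "cmod (f m k - ?z k) \<le> cmod (w k)" .
    next
      fix m k :: nat
      assume "k \<le> m"
      then show "f m k = ?z k"
        unfolding f_apply z using dilation_sieve_eq_unit_seq[OF x1 x0]
        by (intro sum.cong) auto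
    qed
  qed
  show "X \<subseteq> ?C"
  proof
    fix y assume y: "y \<in> X"
    show "y \<in> ?C"
      \<comment> \<open>The error of a truncation is a tail of \<open>y\<close>, so \<open>y\<close>
        itself dominates.\<close>
      by (rule closed[OF trunc[OF y] y y]) auto
  qed
qed

text \<open>An element of the dual lattice annihilating the dilates annihilates their weak closure.
  Both remaining claims rest on this.\<close>

theorem dual_lattice_eq_0:
  assumes x: "x \<in> X" "x \<noteq> 0" "totally_multiplicative x"
    and a: "a \<in> dual_lattice X" "\<And>n. n \<ge> 1 \<Longrightarrow> pairing (dilation n x) a = 0"
    and z: "z \<in> X"
  shows "pairing z a = 0"
proof (rule pairing_closure_of_eq_0[OF a(1)])
  show "pairing u a = 0" if "u \<in> dilation_span x" for u
    using that by (rule pairing_dilation_span_eq_0[OF a(1) x(1) a(2), rotated])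
  show "z \<in> lattice_weak_topology X closure_of dilation_span x"
    unfolding weak_closure_dilation_span[OF x] by (rule z)
qed

end

section \<open>Separating a point from a subspace by a bounded functional\<close>

context banach_sequence_space
begin

lemma exists_dual_separating_subspace:
  assumes M: "cseq.subspace M" "M \<subseteq> X" and z: "z \<in> X"
    and r: "r > 0" "\<And>m. m \<in> M \<Longrightarrow> r \<le> N (z - m)"
  obtains \<phi> where "\<phi> \<in> banach_dual X N" "\<And>m. m \<in> M \<Longrightarrow> \<phi> m = 0" "\<phi> z \<noteq> 0"
proof -
  interpret real_seq: vector_space "\<lambda>c. seq_scale (complex_of_real c)"
    by unfold_locales (auto simp: seq_scale_def fun_eq_iff algebra_simps)
  interpret R: real_subspace "\<lambda>c. seq_scale (complex_of_real c)" X
    by unfold_locales (use subspace in \<open>auto simp: real_seq.subspace_def cseq.subspace_def\<close>)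
  note X_closed = cseq.subspace_0[OF subspace] cseq.subspace_add[OF subspace]
    cseq.subspace_scale[OF subspace] cseq.subspace_neg[OF subspace] cseq.subspace_diff[OF subspace]
  \<comment> \<open>The distance to \<open>M\<close>: sublinear, at most 0 on \<open>M\<close>, and
    at least \<open>r\<close> at \<open>z\<close>. A real-linear \<open>f\<close> below it with
    \<open>f z = p z\<close> therefore separates.\<close>
  define p where "p = (\<lambda>u. INF m\<in>M. N (u - m))"
  have "M \<noteq> {}"
    using cseq.subspace_0[OF M(1)] by blast
  have p_le: "p u \<le> N (u - m)" if "u \<in> X" "m \<in> M" for u m
    unfolding p_def using that M(2)
    by (intro cINF_lower bdd_belowI2[of _ 0] norm_nonneg X_closed) auto
  have p_ge: "s \<le> p u" if "\<And>m. m \<in> M \<Longrightarrow> s \<le> N (u - m)" for s u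
    unfolding p_def using \<open>M \<noteq> {}\<close> that by (rule cINF_greatest)
  have p_le_N: "p u \<le> N u" if "u \<in> X" for u
    using p_le[OF that cseq.subspace_0[OF M(1)]] by simp
  have N_0: "N 0 = 0"
    using norm_eq_0_iff X_closed(1) by simp
  have "R.sublinear p"
    unfolding R.sublinear_def
  proof (intro conjI ballI allI impI)
    fix u v assume uv: "u \<in> X" "v \<in> X"
    have "p (u + v) \<le> N (u - m) + N (v - n)" if "m \<in> M" "n \<in> M" for m n
    proof -
      have "p (u + v) \<le> N ((u + v) - (m + n))"
        using uv that by (intro p_le X_closed cseq.subspace_add[OF M(1)])
      also have "(u + v) - (m + n) = (u - m) + (v - n)"
        by simp
      also have "N \<dots> \<le> N (u - m) + N (v - n)"
        using uv that M(2) by (intro norm_triangle X_closed) auto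
      finally show ?thesis .
    qed
    then have "p (u + v) - N (v - n) \<le> p u" if "n \<in> M" for n
      using that by (intro p_ge) (simp add: algebra_simps)
    then have "p (u + v) - p u \<le> p v"
      by (intro p_ge) (simp add: algebra_simps)
    then show "p (u + v) \<le> p u + p v"
      by simp
  next
    fix c :: real and u assume c: "c \<ge> 0" and u: "u \<in> X"
    show "p (seq_scale (complex_of_real c) u) \<le> c * p u"
    proof (cases "c = 0")
      case True
      then show ?thesis
        using p_le_N[OF X_closed(1)] N_0 by simp
    next
      case False
      with c have "c > 0" by simp
      have "p (seq_scale (complex_of_real c) u) / c \<le> p u"
      proof (rule p_ge)
        fix m assume m: "m \<in> M"
        have "p (seq_scale (complex_of_real c) u)
            \<le> N (seq_scale (complex_of_real c) u - seq_scale (complex_of_real c) m)"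
          using u m by (intro p_le X_closed cseq.subspace_scale[OF M(1)])
        also have "\<dots> = N (seq_scale (complex_of_real c) (u - m))"
          by (simp add: cseq.scale_right_diff_distrib)
        also have "\<dots> = c * N (u - m)"
          using norm_scale[of "u - m" "complex_of_real c"] u m M(2) X_closed(5) \<open>c > 0\<close> by auto
        finally show "p (seq_scale (complex_of_real c) u) / c \<le> N (u - m)"
          using \<open>c > 0\<close> by (simp add: field_simps)
      qed
      then show ?thesis
        using \<open>c > 0\<close> by (simp add: field_simps)
    qed
  qed
  then obtain f where f_add: "\<And>u w. u \<in> X \<Longrightarrow> w \<in> X \<Longrightarrow> f (u + w) = f u + f w"
    and f_scale: "\<And>c u. u \<in> X \<Longrightarrow> f (seq_scale (complex_of_real c) u) = c * f u"
    and f_le: "\<And>u. u \<in> X \<Longrightarrow> f u \<le> p u" and f_z: "f z = p z"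
    using R.hahn_banach[OF _ z] by metis
  have minus: "seq_scale (complex_of_real (- 1)) u = - u" for u
    by (simp add: seq_scale_def fun_eq_iff)
  have f_minus: "f (- u) = - f u" if "u \<in> X" for u
    using f_scale[OF that, of "- 1"] unfolding minus by simp
  have f_bound: "\<bar>f u\<bar> \<le> N u" if "u \<in> X" for u
    using f_le[OF that] f_le[OF X_closed(4)[OF that]] f_minus[OF that] p_le_N[OF that]
      p_le_N[OF X_closed(4)[OF that]] norm_scale[OF that, of "- 1"] minus[of u] by simp
  have f_M: "f m = 0" if "m \<in> M" for m
  proof -
    have "f m \<le> 0" if "m \<in> M" for m
      using f_le[of m] p_le[of m m] that M(2) N_0 by auto
    from this[OF that] this[OF cseq.subspace_neg[OF M(1) that]] show ?thesis
      using f_minus[of m] that M(2) by auto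
  qed
  \<comment> \<open>A complex-linear functional is recovered from its real part.\<close>
  define \<phi> where "\<phi> = restrict (\<lambda>u. Complex (f u) (- f (seq_scale \<i> u))) X"
  have \<phi>: "\<phi> u = Complex (f u) (- f (seq_scale \<i> u))" if "u \<in> X" for u
    using that by (simp add: \<phi>_def)
  show ?thesis
  proof (rule that[of \<phi>])
    show "\<phi> \<in> banach_dual X N"
      unfolding banach_dual_def
    proof (intro CollectI conjI ballI allI exI)
      show "\<phi> \<in> extensional X"
        by (simp add: \<phi>_def)
    next
      fix u v assume "u \<in> X" "v \<in> X"
      then show "\<phi> (u + v) = \<phi> u + \<phi> v"
        by (simp add: \<phi> X_closed f_add cseq.scale_right_distrib complex_eq_iff)
    next
      fix c u assume u: "u \<in> X"
      \<comment> \<open>As \<open>f\<close> is only real-linear, a complex scalar is split into real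
        multiples of \<open>w\<close> and \<open>seq_scale \<i> w\<close>.\<close>
      have c: "seq_scale c w = seq_scale (complex_of_real (Re c)) w
          + seq_scale (complex_of_real (Im c)) (seq_scale \<i> w)" for w
        by (simp add: seq_scale_def fun_eq_iff complex_eq_iff)
      have ii: "seq_scale \<i> (seq_scale \<i> u) = - u"
        by (simp add: seq_scale_def fun_eq_iff)
      have f_c: "f (seq_scale c w) = Re c * f w + Im c * f (seq_scale \<i> w)" if "w \<in> X" for w
        unfolding c using that by (simp add: f_add f_scale X_closed del: cseq.scale_scale)
      have "seq_scale \<i> (seq_scale c u) = seq_scale c (seq_scale \<i> u)"
        by (simp add: mult.commute)
      then show "\<phi> (seq_scale c u) = c * \<phi> u"
        using u by (simp add: \<phi> X_closed f_c ii f_minus complex_eq_iff del: cseq.scale_scale)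
    next
      fix u assume u: "u \<in> X"
      have "cmod (\<phi> u) \<le> \<bar>f u\<bar> + \<bar>f (seq_scale \<i> u)\<bar>"
        using cmod_le[of "\<phi> u"] \<phi>[OF u] by simp
      also have "\<dots> \<le> N u + N (seq_scale \<i> u)"
        using u by (intro add_mono f_bound X_closed)
      finally show "cmod (\<phi> u) \<le> 2 * N u"
        using norm_scale[OF u, of \<i>] by simp
    qed
    \<comment> \<open>\<open>M\<close> is a complex subspace, so the imaginary part vanishes on it
      as well.\<close>
    show "\<phi> m = 0" if "m \<in> M" for m
      using that M(2) f_M cseq.subspace_scale[OF M(1) that] by (auto simp: \<phi> complex_eq_iff)
    have "f z > 0"
      using f_z p_ge[of r z] r by simp
    then show "\<phi> z \<noteq> 0"
      by (simp add: \<phi>[OF z] complex_eq_iff)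
  qed
qed

end

theorem proposition3p1:
  fixes X :: "(nat \<Rightarrow> complex) set" and N :: "(nat \<Rightarrow> complex) \<Rightarrow> real"
    and x :: "nat \<Rightarrow> complex"
  assumes "ISL X N"
    and "x \<in> X" and "x \<noteq> 0"
    and "totally_multiplicative x"
  shows "lattice_weak_topology X closure_of dilation_span x = X \<and>
    (dual_lattice_is_banach_dual X N \<longrightarrow>
      Metric_space.mtopology X (norm_dist X N) closure_of dilation_span x = X) \<and>
    (\<forall>a\<in>dual_lattice X.
      (\<forall>n\<ge>1. (\<Sum>\<^sub>\<infinity>k\<in>{1..}. a (n * k) * x k) = 0) \<longrightarrow> (\<forall>j\<ge>1. a j = 0))"
proof (intro conjI impI ballI allI)
  interpret ISL X N by fact
  note x = assms(2-4)
  show "lattice_weak_topology X closure_of dilation_span x = X"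
    by (rule weak_closure_dilation_span[OF x])
  show "a j = 0" if a: "a \<in> dual_lattice X"
    "\<forall>n\<ge>1. (\<Sum>\<^sub>\<infinity>k\<in>{1..}. a (n * k) * x k) = 0" and j: "j \<ge> 1" for a j
  proof -
    have "pairing (unit_seq j) a = 0"
      using a(2) by (intro dual_lattice_eq_0[OF x a(1) _ unit_seq_in[OF j]]) (simp add: pairing_dilation)
    then show ?thesis
      using pairing_unit_seq[OF j] by simp
  qed
  show "mtopology closure_of dilation_span x = X" if dual: "dual_lattice_is_banach_dual X N"
  proof (rule ccontr)
    assume "mtopology closure_of dilation_span x \<noteq> X"
    then obtain z r where z: "z \<in> X" and r: "r > 0"
      and far: "\<And>m. m \<in> dilation_span x \<Longrightarrow> m \<notin> mball z r"
      unfolding metric_closure_of by blast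
    have "r \<le> N (z - m)" if "m \<in> dilation_span x" for m
      using far[OF that] that z dilation_span_subset[OF x(1)] by (auto simp: in_mball norm_dist_def)
    then obtain \<phi> where \<phi>: "\<phi> \<in> banach_dual X N" "\<And>m. m \<in> dilation_span x \<Longrightarrow> \<phi> m = 0" "\<phi> z \<noteq> 0"
      using exists_dual_separating_subspace[OF _ dilation_span_subset[OF x(1)] z r]
      by (metis cseq.subspace_span dilation_span_def)
    \<comment> \<open>Equality of the duals makes the separating functional a pairing, to which weak
      cyclicity applies.\<close>
    then obtain a where a: "a \<in> dual_lattice X" "\<phi> = restrict (\<lambda>u. pairing u a) X"
      using dual unfolding dual_lattice_is_banach_dual_def by blast
    have "pairing (dilation n x) a = 0" if "n \<ge> 1" for n
    proof -
      have "dilation n x \<in> dilation_span x"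
        using that unfolding dilation_span_def by (intro cseq.span_base) auto
      then show ?thesis
        using \<phi>(2)[of "dilation n x"] dilation_closed[OF that x(1)] a(2) by simp
    qed
    then show False
      using dual_lattice_eq_0[OF x a(1) _ z] \<phi>(3) a(2) z by simp
  qed
qed

end
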